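(* Let $\mathfrak G=\mathbb{Z}[i]$, $K=\mathbb{Q}(i)$, $\mathbb{C}'=\mathbb{C}\setminus K$, and $H=\{x+iy:|x|+|y|\le1\}$. Let $z\in\mathbb{C}'$, let $(a_n)_{n\ge0}$ be a continued fraction expansion of $z$ over $\mathfrak G$ and $(z_n)$ the corresponding iteration sequence. Suppose that for all $n\ge1$: (i) $z_n\in a_n+H$, and (ii) if $|a_n|<3$ then $a_n$ is even. Then the denominator sequence $(q_n)$ of the corresponding $\mathcal Q$-pair satisfies $|q_{n+1}|>|q_n|$ for all $n\ge0$.
   Context: A continued fraction expansion of $z$ is a sequence $(a_n)_{n\ge0}$ in $\mathfrak G$ with a sequence $(z_n)_{n\ge0}$ (iteration sequence) such that $z_0=z$, $0<|z_n-a_n|<1$, $z_{n+1}=(z_n-a_n)^{-1}$ for all $n$. Denominators: $q_{-1}=0$, $q_0=1$, $q_n=a_nq_{n-1}+q_{n-2}$ ($n\ge1$). A Gaussian integer $x+iy$ ($x,y\in\mathbb{Z}$) is even if $x+y$ is even. *)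

theory Defs
  imports Complex_Main
begin

definition gauss_ints :: "complex set" where
  "gauss_ints = {Complex (of_int x) (of_int y) | x y :: int. True}"

definition gauss_rats :: "complex set" where
  "gauss_rats = {Complex (of_rat x) (of_rat y) | x y :: rat. True}"

definition even_gauss_int :: "complex \<Rightarrow> bool" where
  "even_gauss_int a \<longleftrightarrow>
     (\<exists>x y :: int. a = Complex (of_int x) (of_int y) \<and> even (x + y))"

definition H_set :: "complex set" where
  "H_set = {w. \<bar>Re w\<bar> + \<bar>Im w\<bar> \<le> 1}"

definition cf_expansion ::
    "complex \<Rightarrow> (nat \<Rightarrow> complex) \<Rightarrow> (nat \<Rightarrow> complex) \<Rightarrow> bool" where
  "cf_expansion z a zs \<longleftrightarrow>
     (\<forall>n. a n \<in> gauss_ints) \<and> zs 0 = z \<and>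
     (\<forall>n. 0 < norm (zs n - a n) \<and> norm (zs n - a n) < 1 \<and>
          zs (Suc n) = inverse (zs n - a n))"

text \<open>The indices are shifted by one: \<open>cf_denom_shift a k\<close> is \<open>q\<close> with index \<open>k - 1\<close>,
  so that the value at \<open>0\<close> is the conventional \<open>q\<close> with index \<open>-1\<close>.\<close>

fun cf_denom_shift :: "(nat \<Rightarrow> complex) \<Rightarrow> nat \<Rightarrow> complex" where
  "cf_denom_shift a 0 = 0"
| "cf_denom_shift a (Suc 0) = 1"
| "cf_denom_shift a (Suc (Suc n)) =
     a (Suc n) * cf_denom_shift a (Suc n) + cf_denom_shift a n"

definition cf_denom :: "(nat \<Rightarrow> complex) \<Rightarrow> nat \<Rightarrow> complex" where
  "cf_denom a n = cf_denom_shift a (Suc n)"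

end

theory Submission
  imports Defs
begin

text \<open>
  Write \<open>D(b)\<close> for the closed unit disc around \<open>b\<close> and \<open>w n = q (n-1) / q n\<close>, so that
  \<open>w n = 1 / (a n + w (n-1))\<close> and \<open>1 / z (n+1) = z n - a n\<close>. If \<open>b\<close> is one of the four Gaussian
  integers of norm \<open>\<surd>2\<close>, inversion maps \<open>D(b)\<close> onto \<open>D(cnj b)\<close>. Hence \<open>w n \<in> D(-b)\<close> and
  \<open>z (n+1) \<in> D(b)\<close> together give \<open>w (n-1) \<in> D(-d)\<close> and \<open>z n \<in> D(d)\<close> for \<open>d = a n + cnj b\<close>.
  As \<open>\<bar>w (n-1)\<bar> < 1\<close>, we get \<open>\<bar>d\<bar> < 2\<close>; the case \<open>d = 0\<close> contradicts \<open>\<bar>z n\<bar> > 1\<close>, \<open>\<bar>d\<bar> = 1\<close>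
  contradicts the parity of \<open>a n\<close>, and \<open>\<bar>d\<bar> = \<surd>2\<close> is the same situation one step earlier.
  Descending to \<open>w 0 = 0 \<notin> D(-b)\<close>, the situation never occurs. This is what excludes
  \<open>\<bar>a n + w (n-1)\<bar> \<le> 1\<close> when \<open>\<bar>a n\<bar> = \<surd>2\<close>; for \<open>\<bar>a n\<bar> \<ge> 2\<close> the triangle inequality suffices.
\<close>

text \<open>For \<open>\<bar>b\<bar>\<^sup>2 = 2\<close>, expanding gives \<open>\<bar>1 - x * cnj
  b\<bar>\<^sup>2 - \<bar>x\<bar>\<^sup>2 = \<bar>x - b\<bar>\<^sup>2 - 1\<close>; divide by
  \<open>x\<close>.\<close>

lemma cmod_inverse_diff_le:
  assumes "(cmod b)\<^sup>2 = 2" and "cmod (x - b) \<le> 1"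
  shows "cmod (inverse x - cnj b) \<le> 1"
proof -
  have x0: "x \<noteq> 0"
  proof
    assume "x = 0"
    then have "(cmod b)\<^sup>2 \<le> 1"
      using assms(2) by (simp add: power_le_one)
    then show False using assms(1) by simp
  qed
  have "(cmod (x - b))\<^sup>2 \<le> 1"
    using assms(2) by (simp add: power_le_one)
  then have "(cmod (1 - x * cnj b))\<^sup>2 \<le> (cmod x)\<^sup>2"
  proof -
    have "(cmod (1 - x * cnj b))\<^sup>2 = (cmod b)\<^sup>2 * (cmod x)\<^sup>2 + 1 + (cmod (x - b))\<^sup>2 - (cmod x)\<^sup>2 - (cmod b)\<^sup>2"
      unfolding cmod_power2 by (simp add: power2_eq_square algebra_simps)
    with \<open>(cmod (x - b))\<^sup>2 \<le> 1\<close> show ?thesis using assms(1) by simp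
  qed
  then have "cmod (1 - x * cnj b) \<le> cmod x"
    by (rule power2_le_imp_le) simp
  moreover have "inverse x - cnj b = (1 - x * cnj b) / x"
    using x0 by (simp add: field_simps)
  ultimately show ?thesis
    using x0 by (simp add: norm_divide)
qed

text \<open>The squared norm is 0, 1 or 2 and has the parity of \<open>x + y\<close>.\<close>

lemma gauss_int_cmod_less_2_cases:
  assumes "d \<in> gauss_ints" and "cmod d < 2"
  obtains "d = 0" | "cmod d = 1" "\<not> even_gauss_int d" | "(cmod d)\<^sup>2 = 2" "even_gauss_int d"
proof -
  obtain x y :: int where d: "d = Complex (of_int x) (of_int y)"
    using assms(1) by (auto simp: gauss_ints_def)
  have "\<bar>of_int x :: real\<bar> < 2" "\<bar>of_int y :: real\<bar> < 2"
    using abs_Re_le_cmod[of d] abs_Im_le_cmod[of d] assms(2) by (simp_all add: d)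
  then have "x \<in> {-1,0,1}" "y \<in> {-1,0,1}" by auto
  then show thesis
    using that by (auto simp: d even_gauss_int_def cmod_def complex_eq_iff)
qed

lemma gauss_ints_add: "a \<in> gauss_ints \<Longrightarrow> b \<in> gauss_ints \<Longrightarrow> a + b \<in> gauss_ints"
  unfolding gauss_ints_def mem_Collect_eq
proof (elim exE conjE)
  fix x y x' y' :: int
  assume "a = Complex (of_int x) (of_int y)" "b = Complex (of_int x') (of_int y')"
  then show "\<exists>x y :: int. a + b = Complex (of_int x) (of_int y) \<and> True"
    by (intro exI[of _ "x + x'"] exI[of _ "y + y'"]) (simp add: complex_eq_iff)
qed

lemma even_gauss_int_add: "even_gauss_int a \<Longrightarrow> even_gauss_int b \<Longrightarrow> even_gauss_int (a + b)"
  unfolding even_gauss_int_def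
proof (elim exE conjE)
  fix x y x' y' :: int
  assume "a = Complex (of_int x) (of_int y)" "even (x + y)"
    "b = Complex (of_int x') (of_int y')" "even (x' + y')"
  then show "\<exists>x y :: int. a + b = Complex (of_int x) (of_int y) \<and> even (x + y)"
    by (intro exI[of _ "x + x'"] exI[of _ "y + y'"]) (auto simp: complex_eq_iff)
qed

lemma even_gauss_int_cnj: "even_gauss_int a \<Longrightarrow> even_gauss_int (cnj a)"
  unfolding even_gauss_int_def
proof (elim exE conjE)
  fix x y :: int
  assume "a = Complex (of_int x) (of_int y)" "even (x + y)"
  then show "\<exists>x y :: int. cnj a = Complex (of_int x) (of_int y) \<and> even (x + y)"
    by (intro exI[of _ x] exI[of _ "- y"]) (auto simp: complex_eq_iff)
qed

lemma even_gauss_int_imp_gauss_int: "even_gauss_int a \<Longrightarrow> a \<in> gauss_ints"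
  by (auto simp: even_gauss_int_def gauss_ints_def)

lemma no_opposite_discs_step:
  assumes a: "a \<in> gauss_ints" "cmod a < 3 \<Longrightarrow> even_gauss_int a"
    and z: "1 < cmod z" and w: "cmod w < 1"
    and IH: "\<And>b. (cmod b)\<^sup>2 = 2 \<Longrightarrow> even_gauss_int b \<Longrightarrow> cmod (w + b) \<le> 1 \<Longrightarrow> \<not> cmod (z - b) \<le> 1"
    and b: "(cmod b)\<^sup>2 = 2" "even_gauss_int b"
    and wb: "cmod (inverse (a + w) + b) \<le> 1"
  shows "\<not> cmod (inverse (z - a) - b) \<le> 1"
proof
  assume zb: "cmod (inverse (z - a) - b) \<le> 1"
  define d where "d = a + cnj b"
  have "cmod (inverse (inverse (a + w)) - cnj (- b)) \<le> 1"
    by (rule cmod_inverse_diff_le) (use b wb in auto)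
  then have wd: "cmod (w + d) \<le> 1"
    by (simp add: d_def add_ac)
  have "cmod (inverse (inverse (z - a)) - cnj b) \<le> 1"
    by (rule cmod_inverse_diff_le) (use b zb in auto)
  then have zd: "cmod (z - d) \<le> 1"
    by (simp add: d_def algebra_simps)
  have d_int: "d \<in> gauss_ints"
    unfolding d_def using a(1) b(2)
    by (intro gauss_ints_add even_gauss_int_imp_gauss_int[OF even_gauss_int_cnj])
  have "cmod d < 2"
    using norm_triangle_ineq4[of "w + d" w] wd w by simp
  with d_int show False
  proof (cases rule: gauss_int_cmod_less_2_cases)
    case 1
    then show False using zd z by simp
  next
    case 2
    \<comment> \<open>This crude bound gives
      \<open>\<bar>a\<bar> \<le> \<bar>d\<bar> + \<bar>b\<bar> < 3\<close>, so \<open>a\<close>, and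
      with it \<open>d\<close>, is even.\<close>
    have "cmod b < 2"
      by (rule power2_less_imp_less) (use b in auto)
    then have "cmod a < 3"
      using norm_triangle_ineq4[of d "cnj b"] 2 by (simp add: d_def)
    then have "even_gauss_int d"
      unfolding d_def using a(2) b(2) by (intro even_gauss_int_add even_gauss_int_cnj)
    then show False using 2 by simp
  next
    case 3
    then show False using IH wd zd by blast
  qed
qed

lemma cmod_partial_quotient_add_gt_1:
  assumes a: "a \<in> gauss_ints" "cmod a < 3 \<Longrightarrow> even_gauss_int a"
    and z: "1 < cmod z" "cmod (z - a) \<le> 1" and w: "cmod w < 1"
    and IH: "\<And>b. (cmod b)\<^sup>2 = 2 \<Longrightarrow> even_gauss_int b \<Longrightarrow> cmod (w + b) \<le> 1 \<Longrightarrow> \<not> cmod (z - b) \<le> 1"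
  shows "1 < cmod (a + w)"
proof (cases "cmod a < 2")
  case True
  with a(1) show ?thesis
  proof (cases rule: gauss_int_cmod_less_2_cases)
    case 1
    then show ?thesis using z by simp
  next
    case 2
    then show ?thesis using a by simp
  next
    case 3
    \<comment> \<open>\<open>z\<close> lies in the unit disc around \<open>a\<close>, so taking
      \<open>b = a\<close> keeps \<open>w\<close> out of the disc around \<open>-a\<close>.\<close>
    then show ?thesis using IH[of a] z(2) by (metis add.commute not_le)
  qed
next
  case False
  then show ?thesis using norm_triangle_ineq4[of "a + w" w] w by simp
qed

theorem theorem6p5:
  fixes z :: complex and a zs :: "nat \<Rightarrow> complex"
  assumes "z \<notin> gauss_rats"
    and "cf_expansion z a zs"
    and "\<forall>n\<ge>1. zs n \<in> (\<lambda>w. a n + w) ` H_set"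
    and "\<forall>n\<ge>1. norm (a n) < 3 \<longrightarrow> even_gauss_int (a n)"
  shows "\<forall>n. norm (cf_denom a (Suc n)) > norm (cf_denom a n)"
proof -
  \<comment> \<open>The numerator is \<open>q\<close> with index \<open>n - 1\<close>, hence
    \<open>w 0 = 0\<close>.\<close>
  define w where "w n = cf_denom_shift a n / cf_denom a n" for n
  have a_int: "a n \<in> gauss_ints"
    and zs_Suc: "zs (Suc n) = inverse (zs n - a n)"
    and zs_frac: "0 < cmod (zs n - a n)" "cmod (zs n - a n) < 1" for n
    using assms(2) by (auto simp: cf_expansion_def)
  have a_even: "cmod (a (Suc n)) < 3 \<Longrightarrow> even_gauss_int (a (Suc n))" for n
    using assms(4) by simp
  have zs_gt_1: "1 < cmod (zs (Suc n))" for n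
    using zs_frac[of n] by (simp add: zs_Suc norm_inverse one_less_inverse)
  have zs_le_1: "cmod (zs (Suc n) - a (Suc n)) \<le> 1" for n
    using less_imp_le[OF zs_frac(2)] .
  have q_Suc: "cf_denom a (Suc n) = (a (Suc n) + w n) * cf_denom a n" if "cf_denom a n \<noteq> 0" for n
    using that by (simp add: w_def cf_denom_def field_simps)
  \<comment> \<open>All \<open>b\<close> are treated at once because the descent replaces
    \<open>b\<close> by \<open>d\<close>.\<close>
  have inv: "cf_denom a n \<noteq> 0 \<and> cmod (w n) < 1 \<and>
    (\<forall>b. (cmod b)\<^sup>2 = 2 \<longrightarrow> even_gauss_int b \<longrightarrow> cmod (w n + b) \<le> 1 \<longrightarrow> \<not> cmod (zs (Suc n) - b) \<le> 1)"
    for n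
  proof (induction n)
    case 0
    have "\<not> cmod b \<le> 1" if "(cmod b)\<^sup>2 = 2" for b
      using that power_le_one[of "cmod b" 2] by auto
    then show ?case by (simp add: w_def cf_denom_def)
  next
    case (Suc n)
    have gt: "1 < cmod (a (Suc n) + w n)"
      by (rule cmod_partial_quotient_add_gt_1[OF a_int a_even zs_gt_1 zs_le_1]) (use Suc in auto)
    have q: "cf_denom a (Suc n) \<noteq> 0"
      using q_Suc[of n] Suc gt by auto
    have w: "w (Suc n) = inverse (a (Suc n) + w n)"
    proof -
      have "w (Suc n) = cf_denom a n / ((a (Suc n) + w n) * cf_denom a n)"
        using q_Suc[of n] Suc by (simp add: w_def[of "Suc n"] cf_denom_def[symmetric])
      then show ?thesis using Suc by (simp add: divide_inverse)
    qed
    have "\<not> cmod (zs (Suc (Suc n)) - b) \<le> 1"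
      if "(cmod b)\<^sup>2 = 2" "even_gauss_int b" "cmod (w (Suc n) + b) \<le> 1" for b
      unfolding zs_Suc[of "Suc n"]
      by (rule no_opposite_discs_step[OF a_int a_even zs_gt_1, of n "w n"])
        (use Suc that w in auto)
    moreover have "cmod (w (Suc n)) < 1"
      unfolding w norm_inverse using gt by (rule inverse_less_1_iff[THEN iffD2, OF disjI2])
    ultimately show ?case using q by blast
  qed
  show ?thesis
  proof
    fix n
    \<comment> \<open>This is the ratio of consecutive denominators.\<close>
    have "1 < cmod (a (Suc n) + w n)"
      by (rule cmod_partial_quotient_add_gt_1[OF a_int a_even zs_gt_1 zs_le_1]) (use inv[of n] in auto)
    then show "cmod (cf_denom a n) < cmod (cf_denom a (Suc n))"
      using inv[of n] by (simp add: q_Suc norm_mult)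
  qed
qed

end
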